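(* Let $\pi=\pi_2\circ\pi_1$ be an $n$-party protocol computing a deterministic function $f : X_1\times\cdots\times X_n\to Y$, where $\pi_1$ is the combined input and computation phase and $\pi_2$ is the output phase. If $\pi$ is perfect active NI-based secure, then there exists a simulator $\mathcal{S}$ such that $\pi$ is perfect active simulation-based secure (both notions as defined in the context, for a single statically and actively corrupted party).
   Context: Parties $P_1,\dots,P_n$ with inputs $\mathbf{x}\in X_1\times\cdots\times X_n$; one party $P_a$ is statically corrupted by a malicious (active, stateful, possibly rushing) adversary $\mathcal{A}$ that may deviate arbitrarily. $U\sim^p V$ means equality of output distributions for every input. The protocol is $\pi=\pi_2\circ\pi_1$, where $\pi_2$ (output phase) consists of a single round of communication. $\mathsf{view}_i^{\pi_1}(\mathbf{x})$ is the view (own input and all messages sent and received) of $P_i$ after executing $\pi_1$; $\mathsf{output}^\pi(\mathbf{x})=(y_1,\dots,y_n)$ are the outputs of all parties. There is a polynomial-time input extraction function $\mathsf{in}_i$ mapping a view $v$ of $P_i$ after $\pi_1$ to the input $P_i$ is committed to. Perfect active NI-based security: for all $a\in[n]$ and every adversary $\mathcal{A}$ actively corrupting $P_a$: (Correctness) for inputs $\mathbf{x}$ and $v=\mathsf{view}_a^{\pi_1}(\mathbf{x})$, for all $i\ne a$, $\Pr[y_i=f(\mathbf{x}')]=1$ where $\mathbf{x}'_a=\mathsf{in}_a(v)$ and $\mathbf{x}'_j=\mathbf{x}_j$ for $j\ne a$; (Input independence) for all $\mathbf{x},\mathbf{x}'$ with $\mathbf{x}_a=\mathbf{x}'_a$,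 $\{\mathsf{view}_a^{\pi_1}(\mathbf{x})\}\sim^p\{\mathsf{view}_a^{\pi_1}(\mathbf{x}')\}$; (Output simulation) with $v$ and $y=f(\mathbf{x}')$ as in correctness, the final messages $\{m_i\}_{i\ne a}$ sent by the honest parties in $\pi_2$ follow an efficiently samplable distribution $\mathcal{D}_{v,y}$ depending only on $v$ and $y$. Perfect active simulation-based security: Ideal model: honest parties send their inputs to an incorruptible trusted party $T$; the corrupt party $P_a$ sends $x_a$, another input, or an abort symbol $\bot$ (chosen by the adversary, possibly depending on $x_a$ and its state); if any received input is $\bot$, $T$ sends $\bot$ to all; otherwise $T$ sends $y=f(\mathbf{x}')$ to all, where $\mathbf{x}'$ are the received inputs. Honest parties output $y$, the adversary outputs an arbitrary function $g(x_a,y)$; $\mathsf{IDEAL}_{f,\mathcal{S},a}(\mathbf{x})$ is the tuple of these outputs. Real model: $\pi$ is executed with $\mathcal{A}$ sending all messages for $P_a$ arbitrarily and honest parties following $\pi$; $\mathsf{REAL}_{\pi,\mathcal{A},a}(\mathbf{x})$ is the tuple of honest parties' outputs and $\mathcal{A}$'s output. $\pi$ is perfect active simulation-based secure if for every real-model adversary $\mathcal{A}$ there is a polynomial-time ideal-model adversary (simulator) $\mathcal{S}$ such that for every $a\in[n]$, $\{\mathsf{IDEAL}_{f,\mathcal{S},a}(\mathbf{x})\}_{\mathbf{x}}\sim^p\{\mathsf{REAL}_{\pi,\mathcal{A},a}(\mathbf{x})\}_{\mathbf{x}}$.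
   Formalization: Honest parties of the protocol are assumed to run in probabilistic polynomial time, and the simulator is polynomial-time relative to oracle access to the (unbounded) real-model adversary; without these, no polynomial-time simulator need exist. *)

theory Defs
  imports "HOL-Probability.Probability"
begin

section \<open>Data\<close>

text \<open>
  Inputs, messages, local states and views are all binary trees, so that running times can be
  measured in the size of the data.
\<close>

datatype data = Atom | Node data data

fun left :: "data \<Rightarrow> data" where
  "left Atom = Atom"
| "left (Node u v) = u"

fun right :: "data \<Rightarrow> data" where
  "right Atom = Atom"
| "right (Node u v) = v"

primrec len :: "data \<Rightarrow> nat" where
  "len Atom = 1"
| "len (Node u v) = len u + len v + 1"

primrec list_data :: "data list \<Rightarrow> data" where
  "list_data [] = Atom"
| "list_data (d # ds) = Node d (list_data ds)"

text \<open>Lists are read back totally: positions beyond the end of a list contain \<open>Atom\<close>.\<close>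

primrec item :: "data \<Rightarrow> nat \<Rightarrow> data" where
  "item d 0 = left d"
| "item d (Suc k) = item (right d) k"

text \<open>\<open>None\<close> plays the role of the abort symbol.\<close>

primrec of_opt :: "data option \<Rightarrow> data" where
  "of_opt None = Atom"
| "of_opt (Some d) = Node Atom d"

fun to_opt :: "data \<Rightarrow> data option" where
  "to_opt Atom = None"
| "to_opt (Node u v) = Some v"

text \<open>Binary numerals, least significant bit first.\<close>

fun nat_data :: "nat \<Rightarrow> data" where
  "nat_data k =
     (if k = 0 then Atom
      else Node (if even k then Atom else Node Atom Atom) (nat_data (k div 2)))"

declare nat_data.simps [simp del]

primrec data_nat :: "data \<Rightarrow> nat" where
  "data_nat Atom = 0"
| "data_nat (Node b d) = (if b = Atom then 0 else 1) + 2 * data_nat d"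

lemma item_list_data: "k < length ds \<Longrightarrow> item (list_data ds) k = ds ! k"
  by (induction ds arbitrary: k) (auto simp: nth_Cons split: nat.split)

lemma to_opt_of_opt [simp]: "to_opt (of_opt u) = u"
  by (cases u) auto

lemma data_nat_nat_data [simp]: "data_nat (nat_data k) = k"
proof (induction k rule: less_induct)
  case (less k)
  show ?case
  proof (cases "k = 0")
    case True
    then show ?thesis by (simp add: nat_data.simps)
  next
    case False
    then have "data_nat (nat_data (k div 2)) = k div 2" by (intro less) auto
    then show ?thesis using False by (subst nat_data.simps) (auto elim: evenE oddE)
  qed
qed

section \<open>Probabilistic polynomial time\<close>

type_synonym machine = "data \<Rightarrow> data pmf"

text \<open>
  A WHILE language over binary trees in the style of Jones.  \<open>While p\<close> iterates \<open>p\<close> as long as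
  the left subtree of the current value is not \<open>Atom\<close>.  \<open>Rand\<close> reads its argument as a binary
  numeral \<open>N\<close> and returns a uniformly distributed number in \<open>{0..N}\<close>; fair coins are the case
  \<open>N = 1\<close>, and arbitrary \<open>N\<close> is allowed because perfect security typically needs exactly uniform
  elements of a set whose cardinality is not a power of two.  \<open>Call k\<close> queries oracle number \<open>k\<close>.
\<close>

datatype prog =
    Ident
  | Lft
  | Rgt
  | Const data
  | Fork prog prog
  | Seq prog prog
  | Cond prog prog prog
  | While prog
  | Rand
  | Call nat

text \<open>
  \<open>exec_prog Or p x D\<close>: every run of \<open>p\<close> on \<open>x\<close> with oracles \<open>Or\<close> terminates, and \<open>D\<close> is the joint
  distribution of the result, the running time and the log of all oracle queries with their
  answers.  Reading, copying and producing a value is charged with its size, so that the running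
  time also bounds the size of all intermediate values.  A call of an absent oracle has no
  execution.
\<close>

type_synonym run = "data \<times> nat \<times> (data \<times> data) list"

inductive exec_prog ::
  "(nat \<Rightarrow> machine option) \<Rightarrow> prog \<Rightarrow> data \<Rightarrow> run pmf \<Rightarrow> bool"
  for Or :: "nat \<Rightarrow> machine option" where
  "exec_prog Or Ident x (return_pmf (x, len x, []))"
| "exec_prog Or Lft x (return_pmf (left x, len x, []))"
| "exec_prog Or Rgt x (return_pmf (right x, len x, []))"
| "exec_prog Or (Const c) x (return_pmf (c, len c, []))"
| "exec_prog Or p x P \<Longrightarrow> exec_prog Or q x Q \<Longrightarrow>
   exec_prog Or (Fork p q) x
     (bind_pmf P (\<lambda>(y, s, l). map_pmf (\<lambda>(z, t, l'). (Node y z, s + t + len x + 1, l @ l')) Q))"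
| "exec_prog Or p x P \<Longrightarrow>
   (\<And>y s l. (y, s, l) \<in> set_pmf P \<Longrightarrow> exec_prog Or q y (Q y)) \<Longrightarrow>
   exec_prog Or (Seq p q) x
     (bind_pmf P (\<lambda>(y, s, l). map_pmf (\<lambda>(z, t, l'). (z, s + t + 1, l @ l')) (Q y)))"
| "exec_prog Or c x C \<Longrightarrow>
   (\<And>b s l. (b, s, l) \<in> set_pmf C \<Longrightarrow>
      exec_prog Or (if b = Atom then q else p) x (Q b)) \<Longrightarrow>
   exec_prog Or (Cond c p q) x
     (bind_pmf C (\<lambda>(b, s, l). map_pmf (\<lambda>(z, t, l'). (z, s + t + len x + 1, l @ l')) (Q b)))"
| "left x = Atom \<Longrightarrow> exec_prog Or (While p) x (return_pmf (x, len x, []))"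
| "left x \<noteq> Atom \<Longrightarrow> exec_prog Or p x P \<Longrightarrow>
   (\<And>y s l. (y, s, l) \<in> set_pmf P \<Longrightarrow> exec_prog Or (While p) y (Q y)) \<Longrightarrow>
   exec_prog Or (While p) x
     (bind_pmf P (\<lambda>(y, s, l). map_pmf (\<lambda>(z, t, l'). (z, s + t + len x + 1, l @ l')) (Q y)))"
| "exec_prog Or Rand x
     (map_pmf (\<lambda>k. (nat_data k, len x + len (nat_data k), [])) (pmf_of_set {..data_nat x}))"
| "Or k = Some g \<Longrightarrow>
   exec_prog Or (Call k) x (map_pmf (\<lambda>y. (y, len x + len y, [(x, y)])) (g x))"

text \<open>
  Second-order polynomials in the sense of Kapron and Cook: polynomials in the input length \<open>m\<close>
  and in a function \<open>L\<close> that bounds the length of oracle answers in terms of the length of the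
  queries.  If \<open>L\<close> is itself bounded by a polynomial, the result is an ordinary polynomial
  bound in \<open>m\<close>.
\<close>

inductive second_order_poly :: "((nat \<Rightarrow> nat) \<Rightarrow> nat \<Rightarrow> nat) \<Rightarrow> bool" where
  "second_order_poly (\<lambda>L m. c)"
| "second_order_poly (\<lambda>L m. m)"
| "second_order_poly P \<Longrightarrow> second_order_poly Q \<Longrightarrow> second_order_poly (\<lambda>L m. P L m + Q L m)"
| "second_order_poly P \<Longrightarrow> second_order_poly Q \<Longrightarrow> second_order_poly (\<lambda>L m. P L m * Q L m)"
| "second_order_poly P \<Longrightarrow> second_order_poly (\<lambda>L m. L (P L m))"

definition bounds_answers :: "(nat \<Rightarrow> nat) \<Rightarrow> (data \<times> data) list \<Rightarrow> bool" where
  "bounds_answers L l \<longleftrightarrow> mono L \<and> (\<forall>(q, u)\<in>set l. len u \<le> L (len q))"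

definition poly_time_rel :: "(nat \<Rightarrow> machine option) \<Rightarrow> machine \<Rightarrow> bool" where
  "poly_time_rel Or g \<longleftrightarrow>
     (\<exists>p P. second_order_poly P \<and>
        (\<forall>x. \<exists>D. exec_prog Or p x D \<and> map_pmf fst D = g x \<and>
           (\<forall>(y, t, l)\<in>set_pmf D. \<forall>L. bounds_answers L l \<longrightarrow> t \<le> P L (len x))))"

text \<open>
  Without oracles the log is empty and every monotone \<open>L\<close> is admissible, in particular a constant
  one, for which the bound is an ordinary polynomial in the length of the input.
\<close>

definition poly_time :: "machine \<Rightarrow> bool" where
  "poly_time g \<longleftrightarrow> poly_time_rel Map.empty g"

section \<open>Protocols and their executions\<close>

text \<open>
  The parties are \<open>0, \<dots>, n - 1\<close>.  The network is synchronous, with private channels between any two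
  parties and a broadcast channel.  In each round a party maps its local state and the messages
  received in the previous round (as \<open>Node state inbox\<close>) to a new state and its outgoing messages (as
  \<open>Node state outbox\<close>).  Item \<open>j < n\<close> of an outbox is the private message to party \<open>j\<close>, and item \<open>n\<close>
  is broadcast.  Item \<open>i\<close> of an inbox consists of the private message and the broadcast from \<open>i\<close>.

  The first phase of a protocol has \<open>rounds\<close> many rounds, where \<open>comp_step r i\<close> is the action of party
  \<open>i\<close> in round \<open>r\<close>.  The output phase consists of the single round \<open>final_step\<close>, after which
  party \<open>i\<close> computes its output by \<open>out_step i\<close>.
\<close>

record protocol =
  rounds :: nat
  comp_step :: "nat \<Rightarrow> nat \<Rightarrow> machine"
  final_step :: "nat \<Rightarrow> machine"
  out_step :: "nat \<Rightarrow> machine"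

definition poly_time_protocol :: "nat \<Rightarrow> protocol \<Rightarrow> bool" where
  "poly_time_protocol n \<pi> \<longleftrightarrow>
     (\<forall>i<n. (\<forall>r<rounds \<pi>. poly_time (comp_step \<pi> r i)) \<and>
        poly_time (final_step \<pi> i) \<and> poly_time (out_step \<pi> i))"

definition inbox :: "nat \<Rightarrow> (nat \<Rightarrow> data) \<Rightarrow> nat \<Rightarrow> data" where
  "inbox n outboxes j =
     list_data (map (\<lambda>i. Node (item (outboxes i) j) (item (outboxes i) n)) [0..<n])"

text \<open>The part of an outbox that is actually sent.\<close>

definition sent :: "nat \<Rightarrow> data \<Rightarrow> data" where
  "sent n d = list_data (map (item d) [0..<Suc n])"

text \<open>The initial local state of a party is its input, with an empty inbox.\<close>

definition init_states :: "(nat \<Rightarrow> data) \<Rightarrow> nat \<Rightarrow> data" where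
  "init_states x = (\<lambda>i. Node (x i) Atom)"

subsection \<open>Executions without corruption\<close>

definition honest_round :: "nat \<Rightarrow> (nat \<Rightarrow> machine) \<Rightarrow> (nat \<Rightarrow> data) \<Rightarrow> (nat \<Rightarrow> data) pmf" where
  "honest_round n M h =
     map_pmf (\<lambda>res j. Node (left (res j)) (inbox n (\<lambda>i. right (res i)) j))
       (Pi_pmf {..<n} Atom (\<lambda>i. M i (h i)))"

primrec honest_phase1 :: "nat \<Rightarrow> protocol \<Rightarrow> (nat \<Rightarrow> data) \<Rightarrow> nat \<Rightarrow> (nat \<Rightarrow> data) pmf" where
  "honest_phase1 n \<pi> x 0 = return_pmf (init_states x)"
| "honest_phase1 n \<pi> x (Suc r) =
     bind_pmf (honest_phase1 n \<pi> x r) (honest_round n (comp_step \<pi> r))"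

definition honest_outputs :: "nat \<Rightarrow> protocol \<Rightarrow> (nat \<Rightarrow> data) \<Rightarrow> (nat \<Rightarrow> data option) pmf" where
  "honest_outputs n \<pi> x =
     bind_pmf (honest_phase1 n \<pi> x (rounds \<pi>)) (\<lambda>h.
     bind_pmf (honest_round n (final_step \<pi>) h) (\<lambda>h'.
     Pi_pmf {..<n} None (\<lambda>i. map_pmf to_opt (out_step \<pi> i (h' i)))))"

definition computes ::
  "nat \<Rightarrow> (nat \<Rightarrow> data set) \<Rightarrow> protocol \<Rightarrow> ((nat \<Rightarrow> data) \<Rightarrow> data) \<Rightarrow> bool" where
  "computes n X \<pi> f \<longleftrightarrow>
     (\<forall>x \<in> Pi\<^sub>E {..<n} X. \<forall>i<n.
        measure_pmf.prob (honest_outputs n \<pi> x) {y. y i = Some (f x)} = 1)"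

subsection \<open>Executions with one actively corrupted party\<close>

text \<open>
  An adversary corrupting party \<open>a\<close> is stateful and rushing: in round \<open>r\<close>, \<open>act a r\<close> maps its state and
  the messages that the honest parties send to \<open>a\<close> in the same round to a new state and the
  outbox of \<open>a\<close>.  Its initial state is the input of \<open>a\<close>.  Round number \<open>rounds \<pi>\<close> is the
  output phase, and \<open>report a\<close> computes the output of the adversary from its final state.
  No bound is imposed on its computing power.
\<close>

record adversary =
  act :: "nat \<Rightarrow> nat \<Rightarrow> machine"
  report :: "nat \<Rightarrow> machine"

record config =
  honest :: "nat \<Rightarrow> data"
  advst :: data
  transcript :: "data list"

definition corrupt_round ::
  "nat \<Rightarrow> nat \<Rightarrow> (nat \<Rightarrow> machine) \<Rightarrow> machine \<Rightarrow> config \<Rightarrow> config pmf" where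
  "corrupt_round n a M B c =
     bind_pmf (Pi_pmf ({..<n} - {a}) Atom (\<lambda>i. M i (honest c i))) (\<lambda>res.
       let received = inbox n (\<lambda>i. right (res i)) a in
       map_pmf (\<lambda>b.
         let outboxes = (\<lambda>i. if i = a then right b else right (res i)) in
         \<lparr> honest = (\<lambda>j. Node (left (res j)) (inbox n outboxes j)),
           advst = left b,
           transcript = transcript c @ [Node received (sent n (right b))] \<rparr>)
       (B (Node (advst c) received)))"

primrec corrupt_phase1 ::
  "nat \<Rightarrow> protocol \<Rightarrow> adversary \<Rightarrow> nat \<Rightarrow> (nat \<Rightarrow> data) \<Rightarrow> nat \<Rightarrow> config pmf" where
  "corrupt_phase1 n \<pi> A a x 0 =
     return_pmf \<lparr> honest = init_states x, advst = x a, transcript = [] \<rparr>"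
| "corrupt_phase1 n \<pi> A a x (Suc r) =
     bind_pmf (corrupt_phase1 n \<pi> A a x r) (corrupt_round n a (comp_step \<pi> r) (act A a r))"

text \<open>
  The observables of one execution: the view of the corrupted party after the first phase (its
  input and all messages received and sent), the messages it receives from the honest parties in
  the output phase, the outputs of the honest parties (\<open>None\<close> elsewhere), and the output of
  the adversary.
\<close>

record observation =
  view1 :: data
  final_msgs :: data
  outputs :: "nat \<Rightarrow> data option"
  adv_out :: data

definition execution ::
  "nat \<Rightarrow> protocol \<Rightarrow> adversary \<Rightarrow> nat \<Rightarrow> (nat \<Rightarrow> data) \<Rightarrow> observation pmf" where
  "execution n \<pi> A a x =
     bind_pmf (corrupt_phase1 n \<pi> A a x (rounds \<pi>)) (\<lambda>c.
     bind_pmf (corrupt_round n a (final_step \<pi>) (act A a (rounds \<pi>)) c) (\<lambda>c'.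
     bind_pmf (Pi_pmf ({..<n} - {a}) None
                 (\<lambda>i. map_pmf to_opt (out_step \<pi> i (honest c' i)))) (\<lambda>y.
     map_pmf (\<lambda>z.
       \<lparr> view1 = Node (x a) (list_data (transcript c)),
         final_msgs = left (last (transcript c')),
         outputs = y,
         adv_out = z \<rparr>)
     (report A a (advst c')))))"

section \<open>NI-based security\<close>

text \<open>
  \<open>ext i\<close> is the input extraction function of party \<open>i\<close>.  Output simulation says that, jointly with
  the view \<open>v\<close>, the final messages are distributed as \<open>D v (f (x(a := ext a v)))\<close>, that is, this is
  their conditional distribution given \<open>v\<close>.
\<close>

definition ni_correct ::
  "nat \<Rightarrow> (nat \<Rightarrow> data set) \<Rightarrow> ((nat \<Rightarrow> data) \<Rightarrow> data) \<Rightarrow> protocol \<Rightarrow>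
   (nat \<Rightarrow> data \<Rightarrow> data) \<Rightarrow> adversary \<Rightarrow> nat \<Rightarrow> bool" where
  "ni_correct n X f \<pi> ext A a \<longleftrightarrow>
     (\<forall>x \<in> Pi\<^sub>E {..<n} X.
        (\<forall>e\<in>set_pmf (execution n \<pi> A a x). ext a (view1 e) \<in> X a) \<and>
        (\<forall>i<n. i \<noteq> a \<longrightarrow>
           measure_pmf.prob (execution n \<pi> A a x)
             {e. outputs e i = Some (f (x(a := ext a (view1 e))))} = 1))"

definition ni_input_independent ::
  "nat \<Rightarrow> (nat \<Rightarrow> data set) \<Rightarrow> protocol \<Rightarrow> adversary \<Rightarrow> nat \<Rightarrow> bool" where
  "ni_input_independent n X \<pi> A a \<longleftrightarrow>
     (\<forall>x \<in> Pi\<^sub>E {..<n} X. \<forall>x' \<in> Pi\<^sub>E {..<n} X. x a = x' a \<longrightarrow>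
        map_pmf view1 (execution n \<pi> A a x) = map_pmf view1 (execution n \<pi> A a x'))"

definition ni_output_simulatable ::
  "nat \<Rightarrow> (nat \<Rightarrow> data set) \<Rightarrow> ((nat \<Rightarrow> data) \<Rightarrow> data) \<Rightarrow> protocol \<Rightarrow>
   (nat \<Rightarrow> data \<Rightarrow> data) \<Rightarrow> adversary \<Rightarrow> nat \<Rightarrow> bool" where
  "ni_output_simulatable n X f \<pi> ext A a \<longleftrightarrow>
     (\<exists>D :: data \<Rightarrow> data \<Rightarrow> data pmf.
        poly_time (\<lambda>d. D (left d) (right d)) \<and>
        (\<forall>x \<in> Pi\<^sub>E {..<n} X.
           map_pmf (\<lambda>e. (view1 e, final_msgs e)) (execution n \<pi> A a x) =
           bind_pmf (map_pmf view1 (execution n \<pi> A a x))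
             (\<lambda>v. map_pmf (Pair v) (D v (f (x(a := ext a v)))))))"

definition ni_secure ::
  "nat \<Rightarrow> (nat \<Rightarrow> data set) \<Rightarrow> ((nat \<Rightarrow> data) \<Rightarrow> data) \<Rightarrow> protocol \<Rightarrow> bool" where
  "ni_secure n X f \<pi> \<longleftrightarrow>
     (\<exists>ext. (\<forall>i<n. poly_time (\<lambda>v. return_pmf (ext i v))) \<and>
        (\<forall>a<n. \<forall>A.
           ni_correct n X f \<pi> ext A a \<and>
           ni_input_independent n X \<pi> A a \<and>
           ni_output_simulatable n X f \<pi> ext A a))"

section \<open>Simulation-based security\<close>

text \<open>
  \<open>submit a\<close> maps the input of \<open>a\<close> to a state and (encoded by \<open>of_opt\<close>) the input sent to the trusted
  party, or abort.  \<open>conclude a\<close> maps this state and the encoded answer of the trusted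
  party to the output of the ideal-model adversary.
\<close>

record ideal_adversary =
  submit :: "nat \<Rightarrow> machine"
  conclude :: "nat \<Rightarrow> machine"

definition valid_ideal_adversary :: "nat \<Rightarrow> (nat \<Rightarrow> data set) \<Rightarrow> ideal_adversary \<Rightarrow> bool" where
  "valid_ideal_adversary n X S \<longleftrightarrow>
     (\<forall>a<n. \<forall>u\<in>X a. \<forall>d\<in>set_pmf (submit S a u). set_option (to_opt (right d)) \<subseteq> X a)"

definition ideal_model ::
  "nat \<Rightarrow> ((nat \<Rightarrow> data) \<Rightarrow> data) \<Rightarrow> ideal_adversary \<Rightarrow> nat \<Rightarrow> (nat \<Rightarrow> data) \<Rightarrow>
   ((nat \<Rightarrow> data option) \<times> data) pmf" where
  "ideal_model n f S a x =
     bind_pmf (submit S a (x a)) (\<lambda>d.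
       let y = map_option (\<lambda>u. f (x(a := u))) (to_opt (right d)) in
       map_pmf (\<lambda>z. ((\<lambda>i. if i < n \<and> i \<noteq> a then y else None), z))
         (conclude S a (Node (left d) (of_opt y))))"

definition real_model ::
  "nat \<Rightarrow> protocol \<Rightarrow> adversary \<Rightarrow> nat \<Rightarrow> (nat \<Rightarrow> data) \<Rightarrow>
   ((nat \<Rightarrow> data option) \<times> data) pmf" where
  "real_model n \<pi> A a x = map_pmf (\<lambda>e. (outputs e, adv_out e)) (execution n \<pi> A a x)"

text \<open>
  Since real-model adversaries are unbounded and the simulator must reproduce their output, the
  simulator is polynomial-time relative to oracles for the next-message functions and the output
  function of the real-model adversary.
\<close>

definition adv_oracle :: "protocol \<Rightarrow> adversary \<Rightarrow> nat \<Rightarrow> nat \<Rightarrow> machine option" where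
  "adv_oracle \<pi> A a k =
     (case k of
        0 \<Rightarrow> Some (report A a)
      | Suc r \<Rightarrow> if r \<le> rounds \<pi> then Some (act A a r) else None)"

definition poly_time_simulator ::
  "nat \<Rightarrow> protocol \<Rightarrow> adversary \<Rightarrow> ideal_adversary \<Rightarrow> bool" where
  "poly_time_simulator n \<pi> A S \<longleftrightarrow>
     (\<forall>a<n. poly_time_rel (adv_oracle \<pi> A a) (submit S a) \<and>
            poly_time_rel (adv_oracle \<pi> A a) (conclude S a))"

definition sim_secure ::
  "nat \<Rightarrow> (nat \<Rightarrow> data set) \<Rightarrow> ((nat \<Rightarrow> data) \<Rightarrow> data) \<Rightarrow> protocol \<Rightarrow> bool" where
  "sim_secure n X f \<pi> \<longleftrightarrow>
     (\<forall>A. \<exists>S. valid_ideal_adversary n X S \<and> poly_time_simulator n \<pi> A S \<and>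
        (\<forall>a<n. \<forall>x \<in> Pi\<^sub>E {..<n} X. ideal_model n f S a x = real_model n \<pi> A a x))"

end

theory Submission
  imports Defs
begin

text \<open>
  Let \<open>A\<close> be a real-model adversary.  NI-based security is applied not to \<open>A\<close> but to an adversary
  that behaves like \<open>A\<close> and in every round additionally sends its own state as the private message
  of the corrupted party to itself.  Honest parties do not notice this, so the real models agree,
  but the view after the first phase now determines the state of the adversary.  The simulator
  runs the first phase with fixed default inputs for the honest parties, which by input
  independence gives a view \<open>v\<close> with the right distribution, and submits the input extracted from \<open>v\<close>.
  From the answer \<open>y\<close> it samples the final messages by \<open>D v y\<close> and lets \<open>A\<close>, in the state contained in
  \<open>v\<close>, respond to them.  Without the leak one would have to know in addition that given the view, the
  state of the adversary and the final messages are independent.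
\<close>

section \<open>Closure properties of relativised polynomial time\<close>

lemma second_order_poly_mono: "second_order_poly P \<Longrightarrow> mono L \<Longrightarrow> mono (P L)"
  by (induction rule: second_order_poly.induct) (auto simp: mono_def intro: add_mono mult_mono)

lemma second_order_poly_subst:
  "second_order_poly Q \<Longrightarrow> second_order_poly P \<Longrightarrow> second_order_poly (\<lambda>L m. Q L (P L m))"
  by (induction rule: second_order_poly.induct) (auto intro: second_order_poly.intros)

lemma bounds_answers_append [simp]:
  "bounds_answers L (l @ l') \<longleftrightarrow> bounds_answers L l \<and> bounds_answers L l'"
  by (auto simp: bounds_answers_def)

lemma bounds_answers_mono: "bounds_answers L l \<Longrightarrow> mono L"
  by (simp add: bounds_answers_def)

text \<open>Every primitive is charged at least the size of its result, and the costs of parts add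
  up. Thus a time bound for one program bounds the length of the input to the next.\<close>

lemma len_le_time:
  "exec_prog Or p x D \<Longrightarrow> (y, t, l) \<in> set_pmf D \<Longrightarrow> len y \<le> t"
proof (induction arbitrary: y t l rule: exec_prog.induct)
  case (5 p x P q Q)
  from 5(5) obtain u s l1 v t' l2 where *: "(u, s, l1) \<in> set_pmf P" "(v, t', l2) \<in> set_pmf Q"
    "y = Node u v" "t = s + t' + len x + 1"
    by auto
  from 5(3)[OF *(1)] 5(4)[OF *(2)] * show ?case by simp
next
  case (6 p x P q Q)
  from 6(5) obtain u s l1 t' l2 where *: "(u, s, l1) \<in> set_pmf P" "(y, t', l2) \<in> set_pmf (Q u)"
    "t = s + t' + 1"
    by auto
  from 6(4)[OF *(1,2)] * show ?case by simp
next
  case (7 c x C q p Q)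
  from 7(5) obtain u s l1 t' l2 where *: "(u, s, l1) \<in> set_pmf C" "(y, t', l2) \<in> set_pmf (Q u)"
    "t = s + t' + len x + 1"
    by auto
  from 7(4)[OF *(1,2)] * show ?case by simp
next
  case (9 x p P Q)
  from 9(6) obtain u s l1 t' l2 where *: "(u, s, l1) \<in> set_pmf P" "(y, t', l2) \<in> set_pmf (Q u)"
    "t = s + t' + len x + 1"
    by auto
  from 9(5)[OF *(1,2)] * show ?case by simp
next
  case (2 x)
  then show ?case by (cases x) auto
next
  case (3 x)
  then show ?case by (cases x) auto
next
  case (10 x)
  from 10 obtain k where "(y, t, l) = (nat_data k, len x + len (nat_data k), [])"
    by (simp only: set_map_pmf) blast
  then show ?case by simp
next
  case (11 k g x)
  from 11(2) obtain u where "(y, t, l) = (u, len x + len u, [(x, u)])"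
    by (simp only: set_map_pmf) blast
  then show ?case by simp
qed simp_all

text \<open>With no oracles present the rule for \<open>Call\<close> cannot occur in a derivation,
  and no other rule inspects the oracles, so the derivation can be replayed.\<close>

lemma exec_prog_no_oracle:
  "exec_prog Map.empty p x D \<Longrightarrow> exec_prog Or p x D"
proof (induction rule: exec_prog.induct)
  case (5 p x P q Q)
  then show ?case by (intro exec_prog.intros(5))
next
  case (6 p x P q Q)
  show ?case by (rule exec_prog.intros(6)) (fact 6)+
next
  case (7 c x C q p Q)
  show ?case by (rule exec_prog.intros(7)) (fact 7)+
next
  case (9 x p P Q)
  show ?case by (rule exec_prog.intros(9)) (fact 9)+
qed (simp_all add: exec_prog.intros)

lemma poly_time_relI:
  assumes "second_order_poly P" and "\<And>x. exec_prog Or p x (D x)"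
    and "\<And>x. map_pmf fst (D x) = g x"
    and "\<And>x y t l L. (y, t, l) \<in> set_pmf (D x) \<Longrightarrow> bounds_answers L l \<Longrightarrow> t \<le> P L (len x)"
  shows "poly_time_rel Or g"
  unfolding poly_time_rel_def using assms by blast

lemma poly_time_relE:
  assumes "poly_time_rel Or g"
  obtains P p D where "second_order_poly P" and "\<forall>x. exec_prog Or p x (D x)"
    and "\<forall>x. map_pmf fst (D x) = g x"
    and "\<forall>x y t l L. (y, t, l) \<in> set_pmf (D x) \<longrightarrow> bounds_answers L l \<longrightarrow> t \<le> P L (len x)"
proof -
  from assms obtain p P where P: "second_order_poly P" and
    ex: "\<forall>x. \<exists>D. exec_prog Or p x D \<and> map_pmf fst D = g x \<and>
           (\<forall>(y, t, l)\<in>set_pmf D. \<forall>L. bounds_answers L l \<longrightarrow> t \<le> P L (len x))"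
    unfolding poly_time_rel_def by blast
  \<comment> \<open>The runs become a function of the input, because the rule for \<open>Seq\<close>
    needs the executions of its second program as a family indexed by the intermediate
    value.\<close>
  from choice[OF ex] obtain D where D: "\<forall>x. exec_prog Or p x (D x) \<and> map_pmf fst (D x) = g x \<and>
           (\<forall>(y, t, l)\<in>set_pmf (D x). \<forall>L. bounds_answers L l \<longrightarrow> t \<le> P L (len x))" ..
  have "t \<le> P L (len x)" if "(y, t, l) \<in> set_pmf (D x)" "bounds_answers L l" for x y t l L
    using bspec[OF conjunct2[OF conjunct2[OF spec[OF D]]] that(1)] that(2) by simp
  with D show thesis
    by (intro that[OF P, of p D]) simp_all
qed

lemma poly_time_imp_rel:
  assumes "poly_time g"
  shows "poly_time_rel Or g"
proof -
  obtain P p D where P: "second_order_poly P" and D: "\<forall>x. exec_prog Map.empty p x (D x)"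
    and g: "\<forall>x. map_pmf fst (D x) = g x"
    and t: "\<forall>x y t l L. (y, t, l) \<in> set_pmf (D x) \<longrightarrow> bounds_answers L l \<longrightarrow> t \<le> P L (len x)"
    by (rule poly_time_relE[OF assms[unfolded poly_time_def]])
  note D = D[rule_format] and g = g[rule_format] and t = t[rule_format]
  show ?thesis
    by (rule poly_time_relI[OF P exec_prog_no_oracle[OF D] g t])
qed

section \<open>Primitive programs, oracle queries, composition and pairing\<close>

lemma poly_time_rel_id: "poly_time_rel Or (\<lambda>x. return_pmf x)"
  by (rule poly_time_relI[OF second_order_poly.intros(2) exec_prog.intros(1)]) auto

lemma poly_time_rel_lft: "poly_time_rel Or (\<lambda>x. return_pmf (left x))"
  by (rule poly_time_relI[OF second_order_poly.intros(2) exec_prog.intros(2)]) auto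

lemma poly_time_rel_rgt: "poly_time_rel Or (\<lambda>x. return_pmf (right x))"
  by (rule poly_time_relI[OF second_order_poly.intros(2) exec_prog.intros(3)]) auto

lemma poly_time_rel_const: "poly_time_rel Or (\<lambda>x. return_pmf c)"
  by (rule poly_time_relI[OF second_order_poly.intros(1) exec_prog.intros(4)]) auto

text \<open>The log of a single call consists of the query and its answer, so every \<open>L\<close>
  admissible for the log bounds the cost by \<open>m + L m\<close>, where \<open>m\<close> is the
  length of the query.\<close>

lemma poly_time_rel_oracle: "Or k = Some g \<Longrightarrow> poly_time_rel Or g"
  by (rule poly_time_relI[OF second_order_poly.intros(3)
        [OF second_order_poly.intros(2) second_order_poly.intros(5)[OF second_order_poly.intros(2)]]
        exec_prog.intros(11)])
     (auto simp: pmf.map_comp o_def bounds_answers_def)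

lemma poly_time_rel_seq:
  assumes "poly_time_rel Or g" and "poly_time_rel Or h"
  shows "poly_time_rel Or (\<lambda>x. bind_pmf (g x) h)"
proof -
  obtain P p D where P: "second_order_poly P" and D: "\<forall>x. exec_prog Or p x (D x)"
    and g: "\<forall>x. map_pmf fst (D x) = g x"
    and tP: "\<forall>x y t l L. (y, t, l) \<in> set_pmf (D x) \<longrightarrow> bounds_answers L l \<longrightarrow> t \<le> P L (len x)"
    by (rule poly_time_relE[OF assms(1)])
  obtain Q q E where Q: "second_order_poly Q" and E: "\<forall>x. exec_prog Or q x (E x)"
    and h: "\<forall>x. map_pmf fst (E x) = h x"
    and tQ: "\<forall>x y t l L. (y, t, l) \<in> set_pmf (E x) \<longrightarrow> bounds_answers L l \<longrightarrow> t \<le> Q L (len x)"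
    by (rule poly_time_relE[OF assms(2)])
  note D = D[rule_format] and g = g[rule_format] and tP = tP[rule_format]
    and E = E[rule_format] and h = h[rule_format] and tQ = tQ[rule_format]
  \<comment> \<open>The intermediate value has length at most \<open>P L m\<close>. As
    \<open>Q L\<close> is monotone, the second program takes time at most
    \<open>Q L (P L m)\<close>; the 1 is the charge of \<open>Seq\<close>.\<close>
  have "second_order_poly (\<lambda>L m. P L m + Q L (P L m) + 1)"
    by (rule second_order_poly.intros(3)[OF second_order_poly.intros(3)
          [OF P second_order_poly_subst[OF Q P]] second_order_poly.intros(1)])
  then show ?thesis
  proof (rule poly_time_relI)
    fix x
    show "exec_prog Or (Seq p q) x (bind_pmf (D x) (\<lambda>(y, s, l). map_pmf (\<lambda>(z, t, l'). (z, s + t + 1, l @ l')) (E y)))"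
      by (rule exec_prog.intros(6)[OF D E])
    show "map_pmf fst (bind_pmf (D x) (\<lambda>(y, s, l). map_pmf (\<lambda>(z, t, l'). (z, s + t + 1, l @ l')) (E y)))
      = bind_pmf (g x) h"
      by (simp add: g[symmetric] h[symmetric] map_bind_pmf bind_map_pmf pmf.map_comp o_def case_prod_unfold)
  next
    fix x z t l L
    assume "(z, t, l) \<in> set_pmf (bind_pmf (D x) (\<lambda>(y, s, l). map_pmf (\<lambda>(z, t, l'). (z, s + t + 1, l @ l')) (E y)))"
      and b: "bounds_answers L l"
    then obtain y s l1 t' l2 where 1: "(y, s, l1) \<in> set_pmf (D x)" "(z, t', l2) \<in> set_pmf (E y)"
      "t = s + t' + 1" "l = l1 @ l2"
      by auto
    have b12: "bounds_answers L l1" "bounds_answers L l2" using b 1(4) by simp_all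
    have s: "s \<le> P L (len x)" by (rule tP[OF 1(1) b12(1)])
    have "len y \<le> P L (len x)" using len_le_time[OF D 1(1)] s by simp
    then have "Q L (len y) \<le> Q L (P L (len x))"
      using second_order_poly_mono[OF Q bounds_answers_mono[OF b]] by (auto simp: mono_def)
    moreover have "t' \<le> Q L (len y)" by (rule tQ[OF 1(2) b12(2)])
    ultimately show "t \<le> P L (len x) + Q L (P L (len x)) + 1" using s 1 by simp
  qed
qed

lemma poly_time_rel_fork:
  assumes "poly_time_rel Or g" and "poly_time_rel Or h"
  shows "poly_time_rel Or (\<lambda>x. bind_pmf (g x) (\<lambda>y. map_pmf (Node y) (h x)))"
proof -
  obtain P p D where P: "second_order_poly P" and D: "\<forall>x. exec_prog Or p x (D x)"
    and g: "\<forall>x. map_pmf fst (D x) = g x"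
    and tP: "\<forall>x y t l L. (y, t, l) \<in> set_pmf (D x) \<longrightarrow> bounds_answers L l \<longrightarrow> t \<le> P L (len x)"
    by (rule poly_time_relE[OF assms(1)])
  obtain Q q E where Q: "second_order_poly Q" and E: "\<forall>x. exec_prog Or q x (E x)"
    and h: "\<forall>x. map_pmf fst (E x) = h x"
    and tQ: "\<forall>x y t l L. (y, t, l) \<in> set_pmf (E x) \<longrightarrow> bounds_answers L l \<longrightarrow> t \<le> Q L (len x)"
    by (rule poly_time_relE[OF assms(2)])
  note D = D[rule_format] and g = g[rule_format] and tP = tP[rule_format]
    and E = E[rule_format] and h = h[rule_format] and tQ = tQ[rule_format]
  have "second_order_poly (\<lambda>L m. P L m + Q L m + m + 1)"
    by (rule second_order_poly.intros(3)[OF second_order_poly.intros(3)[OF second_order_poly.intros(3)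
          [OF P Q] second_order_poly.intros(2)] second_order_poly.intros(1)])
  then show ?thesis
  proof (rule poly_time_relI)
    fix x
    let ?F = "bind_pmf (D x) (\<lambda>(y, s, l).
      map_pmf (\<lambda>(z, t, l'). (Node y z, s + t + len x + 1, l @ l')) (E x))"
    show "exec_prog Or (Fork p q) x ?F"
      by (rule exec_prog.intros(5)[OF D E])
    show "map_pmf fst ?F = bind_pmf (g x) (\<lambda>y. map_pmf (Node y) (h x))"
      by (simp add: g[symmetric] h[symmetric] map_bind_pmf bind_map_pmf pmf.map_comp o_def case_prod_unfold)
    fix z t l L
    assume "(z, t, l) \<in> set_pmf ?F" and b: "bounds_answers L l"
    then obtain s l1 t' l2 y z' where 1: "(y, s, l1) \<in> set_pmf (D x)" "(z', t', l2) \<in> set_pmf (E x)"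
      "t = s + t' + len x + 1" "l = l1 @ l2"
      by auto
    have "bounds_answers L l1" "bounds_answers L l2" using b 1(4) by simp_all
    from tP[OF 1(1) this(1)] tQ[OF 1(2) this(2)] show "t \<le> P L (len x) + Q L (len x) + len x + 1" using 1 by simp
  qed
qed

lemma poly_time_rel_comp:
  assumes "poly_time_rel Or g" and "poly_time_rel Or (\<lambda>x. return_pmf (F x))"
  shows "poly_time_rel Or (\<lambda>x. g (F x))"
  using poly_time_rel_seq[OF assms(2,1)] by (simp add: bind_return_pmf)

text \<open>The program keeps its input by forking it with the output of \<open>g\<close>. The
  continuation receives both as one tree, which \<open>left\<close> and \<open>right\<close>
  unpack.\<close>

lemma poly_time_rel_bind:
  assumes "poly_time_rel Or g" and "poly_time_rel Or (\<lambda>d. h (left d) (right d))"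
  shows "poly_time_rel Or (\<lambda>x. bind_pmf (g x) (\<lambda>y. h x y))"
  using poly_time_rel_seq[OF poly_time_rel_fork[OF poly_time_rel_id assms(1)] assms(2)]
  by (simp add: bind_return_pmf bind_map_pmf)

lemma poly_time_rel_map:
  assumes "poly_time_rel Or g" and "poly_time_rel Or (\<lambda>d. return_pmf (F (left d) (right d)))"
  shows "poly_time_rel Or (\<lambda>x. map_pmf (\<lambda>y. F x y) (g x))"
  using poly_time_rel_bind[OF assms(1), of "\<lambda>x y. return_pmf (F x y)"] assms(2)
  by (simp add: map_pmf_def)

section \<open>Deterministic tree functions and independent products\<close>

lemma poly_time_rel_left:
  "poly_time_rel Or (\<lambda>x. return_pmf (F x)) \<Longrightarrow> poly_time_rel Or (\<lambda>x. return_pmf (left (F x)))"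
  by (rule poly_time_rel_comp[OF poly_time_rel_lft])

lemma poly_time_rel_right:
  "poly_time_rel Or (\<lambda>x. return_pmf (F x)) \<Longrightarrow> poly_time_rel Or (\<lambda>x. return_pmf (right (F x)))"
  by (rule poly_time_rel_comp[OF poly_time_rel_rgt])

lemma poly_time_rel_Node:
  "poly_time_rel Or (\<lambda>x. return_pmf (F x)) \<Longrightarrow> poly_time_rel Or (\<lambda>x. return_pmf (G x)) \<Longrightarrow>
   poly_time_rel Or (\<lambda>x. return_pmf (Node (F x) (G x)))"
  using poly_time_rel_fork[of Or "\<lambda>x. return_pmf (F x)" "\<lambda>x. return_pmf (G x)"]
  by (simp add: bind_return_pmf)

text \<open>The index \<open>k\<close> is fixed, so the program may depend on it. In the same way
  \<open>n\<close>, \<open>a\<close> and the round numbers are built into the programs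
  below.\<close>

lemma poly_time_rel_item:
  "poly_time_rel Or (\<lambda>x. return_pmf (F x)) \<Longrightarrow> poly_time_rel Or (\<lambda>x. return_pmf (item (F x) k))"
proof (induction k arbitrary: F)
  case (Suc k)
  from Suc.IH[OF poly_time_rel_right[OF Suc.prems]] show ?case by simp
qed (simp add: poly_time_rel_left)

lemma poly_time_rel_Cons:
  "poly_time_rel Or (\<lambda>x. return_pmf (F x)) \<Longrightarrow>
   poly_time_rel Or (\<lambda>x. return_pmf (list_data (G x))) \<Longrightarrow>
   poly_time_rel Or (\<lambda>x. return_pmf (list_data (F x # G x)))"
  by (simp add: poly_time_rel_Node)

lemma poly_time_rel_list_append:
  assumes "\<And>i. i \<in> set ks \<Longrightarrow> poly_time_rel Or (\<lambda>x. return_pmf (F i x))"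
    and "poly_time_rel Or (\<lambda>x. return_pmf (list_data (G x)))"
  shows "poly_time_rel Or (\<lambda>x. return_pmf (list_data (map (\<lambda>i. F i x) ks @ G x)))"
  using assms by (induction ks) (auto intro: poly_time_rel_Node)

lemma poly_time_rel_list:
  assumes "\<And>i. i \<in> set ks \<Longrightarrow> poly_time_rel Or (\<lambda>x. return_pmf (F i x))"
  shows "poly_time_rel Or (\<lambda>x. return_pmf (list_data (map (\<lambda>i. F i x) ks)))"
  using poly_time_rel_list_append[of ks Or F "\<lambda>_. []"] assms poly_time_rel_const[of Or Atom] by simp

text \<open>The condition \<open>b\<close> does not depend on the input, so one of the two programs
  is selected once and for all and no \<open>Cond\<close> is executed.\<close>

lemma poly_time_rel_if:
  assumes "poly_time_rel Or (\<lambda>x. return_pmf (F x))" and "poly_time_rel Or (\<lambda>x. return_pmf (G x))"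
  shows "poly_time_rel Or (\<lambda>x. return_pmf (if b then F x else G x))"
  using assms by (cases b) simp_all

lemma poly_time_rel_inbox:
  assumes "\<And>i. i < n \<Longrightarrow> poly_time_rel Or (\<lambda>x. return_pmf (F i x))"
  shows "poly_time_rel Or (\<lambda>x. return_pmf (inbox n (\<lambda>i. F i x) j))"
  unfolding inbox_def
  by (intro poly_time_rel_list poly_time_rel_Node poly_time_rel_item assms) auto

lemma poly_time_rel_sent:
  assumes "poly_time_rel Or (\<lambda>x. return_pmf (F x))"
  shows "poly_time_rel Or (\<lambda>x. return_pmf (sent n (F x)))"
  unfolding sent_def by (intro poly_time_rel_list poly_time_rel_item assms)

lemmas poly_time_rel_intros =
  poly_time_rel_id poly_time_rel_const poly_time_rel_left poly_time_rel_right poly_time_rel_Node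
  poly_time_rel_item poly_time_rel_list poly_time_rel_list_append poly_time_rel_Cons poly_time_rel_if
  poly_time_rel_inbox poly_time_rel_sent

text \<open>An independent product is sampled one component at a time, forking each component with
  the sampler for the remaining list.\<close>

lemma poly_time_rel_Pi_pmf:
  assumes "\<And>i. i \<in> set ks \<Longrightarrow> poly_time_rel Or (g i)" and "distinct ks"
  shows "poly_time_rel Or
    (\<lambda>x. map_pmf (\<lambda>res. list_data (map res ks)) (Pi_pmf (set ks) Atom (\<lambda>i. g i x)))"
  using assms
proof (induction ks)
  case Nil
  then show ?case by (simp add: poly_time_rel_const)
next
  case (Cons k ks)
  have "map_pmf (\<lambda>res. list_data (map res (k # ks))) (Pi_pmf (set (k # ks)) Atom (\<lambda>i. g i x)) =
     bind_pmf (g k x) (\<lambda>y. map_pmf (Node y)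
       (map_pmf (\<lambda>res. list_data (map res ks)) (Pi_pmf (set ks) Atom (\<lambda>i. g i x))))" for x
  proof -
    \<comment> \<open>By distinctness \<open>k\<close> is not in \<open>ks\<close>, so the new
      component does not disturb the tail.\<close>
    have "map (res(k := y)) ks = map res ks" for res and y :: data
      using Cons.prems by auto
    then show ?thesis using Cons.prems
      by (simp add: Pi_pmf_insert pair_pmf_def map_bind_pmf pmf.map_comp o_def
            bind_return_pmf map_pmf_def bind_assoc_pmf)
  qed
  then show ?case using Cons by (auto intro: poly_time_rel_fork)
qed

section \<open>Leaking the adversary's state into the view\<close>

text \<open>For \<open>a < n\<close>, item \<open>a\<close> is a free channel: honest parties do not
  read it, and the messages handed to the adversary are computed from honest outboxes only. The list
  includes index \<open>n\<close>, which is the broadcast.\<close>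

definition leak_outbox :: "nat \<Rightarrow> nat \<Rightarrow> data \<Rightarrow> data" where
  "leak_outbox n a b =
     list_data (map (\<lambda>j. if j = a then left b else item (right b) j) [0..<Suc n])"

definition leak :: "nat \<Rightarrow> nat \<Rightarrow> machine \<Rightarrow> machine" where
  "leak n a B d = map_pmf (\<lambda>b. Node (left b) (leak_outbox n a b)) (B d)"

definition leaky :: "nat \<Rightarrow> adversary \<Rightarrow> adversary" where
  "leaky n A = \<lparr>act = (\<lambda>a r. leak n a (act A a r)), report = report A\<rparr>"

lemma leaky_simps [simp]:
  "act (leaky n A) a r = leak n a (act A a r)" "report (leaky n A) = report A"
  by (simp_all add: leaky_def)

lemma item_leak_outbox [simp]:
  "j \<le> n \<Longrightarrow> item (leak_outbox n a b) j = (if j = a then left b else item (right b) j)"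
  unfolding leak_outbox_def by (subst item_list_data) (auto simp del: upt_Suc)

lemma item_sent [simp]: "j \<le> n \<Longrightarrow> item (sent n d) j = item d j"
  unfolding sent_def by (subst item_list_data) (auto simp del: upt_Suc)

section \<open>Invisibility of the leak to the honest parties\<close>

lemma inbox_cong: "(\<And>i. i < n \<Longrightarrow> item (u i) j = item (v i) j \<and> item (u i) n = item (v i) n) \<Longrightarrow>
    inbox n u j = inbox n v j"
  unfolding inbox_def by (intro arg_cong[where f = list_data] map_cong) auto

text \<open>Both continuations factor through \<open>g\<close> by the same \<open>H\<close>, so only
  the image distribution matters. This acts as a bisimulation rule for executions that agree only up
  to \<open>core\<close>.\<close>

lemma bind_pmf_quotient_cong:
  assumes "map_pmf g p = map_pmf g q" and "\<And>c c'. g c = g c' \<Longrightarrow> F c = G c'"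
  shows "bind_pmf p F = bind_pmf q G"
proof -
  define H where "H z = F (inv g z)" for z
  have g_inv: "g (inv g (g c)) = g c" for c by (simp add: f_inv_into_f)
  have F: "F c = H (g c)" and G: "G c = H (g c)" for c
    unfolding H_def using assms(2)[of c c] assms(2)[of "inv g (g c)" c] g_inv by auto
  have "bind_pmf p F = bind_pmf (map_pmf g p) H" by (simp add: bind_map_pmf F[symmetric])
  also have "\<dots> = bind_pmf q G" unfolding assms(1) by (simp add: bind_map_pmf G[symmetric])
  finally show ?thesis .
qed

text \<open>What the rest of the execution depends on, apart from the record of the view.\<close>

definition core :: "nat \<Rightarrow> nat \<Rightarrow> config \<Rightarrow> (nat \<Rightarrow> data) \<times> data" where
  "core n a c = ((\<lambda>i. if i < n \<and> i \<noteq> a then honest c i else Atom), advst c)"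

lemma core_eqD:
  assumes "core n a c = core n a c'"
  shows "advst c = advst c'" and "i < n \<Longrightarrow> i \<noteq> a \<Longrightarrow> honest c i = honest c' i"
  using assms unfolding core_def by (auto dest: fun_cong[where x = i])

text \<open>Honest party \<open>j\<close> reads items \<open>j\<close> and \<open>n\<close> of the
  outbox of \<open>a\<close>, and both differ from item \<open>a\<close> because
  \<open>a < n\<close>. The slot \<open>a\<close> of \<open>honest\<close>, which does receive the
  leak, is masked by \<open>core\<close>, and the transcript is left out of it.\<close>

lemma core_corrupt_round_leak:
  assumes "a < n" and "core n a c = core n a c'"
  shows "map_pmf (core n a) (corrupt_round n a M (leak n a B) c) =
         map_pmf (core n a) (corrupt_round n a M B c')"
proof -
  have 1: "Pi_pmf ({..<n} - {a}) Atom (\<lambda>i. M i (honest c i)) =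
        Pi_pmf ({..<n} - {a}) Atom (\<lambda>i. M i (honest c' i))"
    by (rule Pi_pmf_cong) (auto simp: core_eqD[OF assms(2)])
  have 2: "inbox n (\<lambda>i. if i = a then leak_outbox n a b else right (res i)) j =
      inbox n (\<lambda>i. if i = a then right b else right (res i)) j" if "j < n" "j \<noteq> a" for b j res
    by (rule inbox_cong) (use that assms in auto)
  show ?thesis
    unfolding corrupt_round_def 1 core_eqD(1)[OF assms(2)]
    by (auto simp: map_bind_pmf leak_def pmf.map_comp o_def Let_def core_def 2 cong: if_cong
        intro!: bind_pmf_cong map_pmf_cong)
qed

lemma core_corrupt_phase1_leaky:
  assumes "a < n"
  shows "map_pmf (core n a) (corrupt_phase1 n \<pi> (leaky n A) a x r) =
         map_pmf (core n a) (corrupt_phase1 n \<pi> A a x r)"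
proof (induction r)
  case (Suc r)
  show ?case
    unfolding corrupt_phase1.simps map_bind_pmf leaky_simps
    by (rule bind_pmf_quotient_cong[OF Suc core_corrupt_round_leak[OF assms]])
qed simp

lemma real_model_leaky:
  assumes "a < n"
  shows "real_model n \<pi> (leaky n A) a x = real_model n \<pi> A a x"
proof -
  \<comment> \<open>Once the view is dropped from the observation, what follows the first phase
    depends on the configuration only through \<open>core\<close>.\<close>
  have eq: "real_model n \<pi> A a x = bind_pmf (corrupt_phase1 n \<pi> A a x (rounds \<pi>)) (\<lambda>c.
     bind_pmf (corrupt_round n a (final_step \<pi>) (act A a (rounds \<pi>)) c) (\<lambda>c'.
     bind_pmf (Pi_pmf ({..<n} - {a}) None
                 (\<lambda>i. map_pmf to_opt (out_step \<pi> i (honest c' i)))) (\<lambda>y.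
     map_pmf (Pair y) (report A a (advst c')))))" for A
    by (simp add: real_model_def execution_def map_bind_pmf pmf.map_comp o_def)
  show ?thesis
    unfolding eq leaky_simps
  proof (rule bind_pmf_quotient_cong[OF core_corrupt_phase1_leaky[OF assms]],
         rule bind_pmf_quotient_cong[OF core_corrupt_round_leak[OF assms]], assumption)
    fix c c' :: config
    assume c: "core n a c = core n a c'"
    have "Pi_pmf ({..<n} - {a}) None (\<lambda>i. map_pmf to_opt (out_step \<pi> i (honest c i))) =
      Pi_pmf ({..<n} - {a}) None (\<lambda>i. map_pmf to_opt (out_step \<pi> i (honest c' i)))"
      by (rule Pi_pmf_cong) (auto simp: core_eqD[OF c])
    then show "bind_pmf (Pi_pmf ({..<n} - {a}) None (\<lambda>i. map_pmf to_opt (out_step \<pi> i (honest c i))))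
        (\<lambda>y. map_pmf (Pair y) (report A a (advst c))) =
      bind_pmf (Pi_pmf ({..<n} - {a}) None (\<lambda>i. map_pmf to_opt (out_step \<pi> i (honest c' i))))
        (\<lambda>y. map_pmf (Pair y) (report A a (advst c')))"
      by (simp add: core_eqD(1)[OF c])
  qed
qed

section \<open>The adversary's state as a function of the view\<close>

lemma length_transcript:
  "c \<in> set_pmf (corrupt_phase1 n \<pi> A a x r) \<Longrightarrow> length (transcript c) = r"
  by (induction r arbitrary: c) (auto simp: corrupt_round_def Let_def)

text \<open>After \<open>r\<close> rounds the latest transcript entry has index
  \<open>r - 1\<close>; its right part is what was sent, and item \<open>a\<close> of that is the
  leak. Before the first round the state is the input, the left part of the view.\<close>

definition leaked_state :: "nat \<Rightarrow> nat \<Rightarrow> data \<Rightarrow> data" where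
  "leaked_state r a v = (if r = 0 then left v else item (right (item (right v) (r - 1))) a)"

lemma advst_leaky:
  assumes "a < n" and "c \<in> set_pmf (corrupt_phase1 n \<pi> (leaky n A) a x r)"
  shows "advst c = leaked_state r a (Node (x a) (list_data (transcript c)))"
proof (cases r)
  case 0
  with assms show ?thesis by (simp add: leaked_state_def)
next
  case (Suc k)
  with assms(2) obtain c0 where c0: "c0 \<in> set_pmf (corrupt_phase1 n \<pi> (leaky n A) a x k)"
    and c: "c \<in> set_pmf (corrupt_round n a (comp_step \<pi> k) (leak n a (act A a k)) c0)"
    by auto
  from length_transcript[OF c0] c show ?thesis
    using \<open>a < n\<close>
    by (auto simp: corrupt_round_def Let_def leak_def leaked_state_def Suc item_list_data nth_append)
qed

definition reply :: "adversary \<Rightarrow> nat \<Rightarrow> nat \<Rightarrow> data \<Rightarrow> machine" where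
  "reply A r a v m =
     bind_pmf (act A a r (Node (leaked_state r a v) m)) (\<lambda>b. report A a (left b))"

lemma map_view1_execution:
  "map_pmf view1 (execution n \<pi> A a x) =
   map_pmf (\<lambda>c. Node (x a) (list_data (transcript c))) (corrupt_phase1 n \<pi> A a x (rounds \<pi>))"
  by (simp add: execution_def map_bind_pmf pmf.map_comp o_def map_pmf_const bind_pmf_const)
     (simp add: map_pmf_def)

text \<open>By \<open>advst_leaky\<close> the view determines the state in which \<open>A\<close>
  enters the output phase. Given also the final messages, the report uses only fresh randomness,
  independent of how the honest parties arrived at these messages.\<close>

lemma map_adv_out_execution_leaky:
  assumes "a < n"
  shows "map_pmf (\<lambda>e. (view1 e, final_msgs e, adv_out e)) (execution n \<pi> (leaky n A) a x) =
    bind_pmf (map_pmf (\<lambda>e. (view1 e, final_msgs e)) (execution n \<pi> (leaky n A) a x))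
      (\<lambda>(v, m). map_pmf (\<lambda>z. (v, m, z)) (reply A (rounds \<pi>) a v m))"
  by (auto simp: execution_def map_bind_pmf bind_map_pmf pmf.map_comp o_def map_pmf_const bind_pmf_const
        bind_assoc_pmf bind_return_pmf corrupt_round_def Let_def leak_def reply_def
        advst_leaky[OF assms] intro!: bind_pmf_cong)

section \<open>The simulator\<close>

definition encode :: "nat \<Rightarrow> config \<Rightarrow> data" where
  "encode n c = Node (list_data (map (honest c) [0..<n]))
     (Node (advst c) (list_data (transcript c)))"

text \<open>Programs work on trees, so a round is replayed on encoded configurations. The constant
  \<open>Atom\<close> for party \<open>a\<close> lets the product range over a full list of parties,
  and the old transcript can be copied item by item because its length \<open>r\<close> is
  known.\<close>

definition sim_round :: "nat \<Rightarrow> nat \<Rightarrow> (nat \<Rightarrow> machine) \<Rightarrow> machine \<Rightarrow> nat \<Rightarrow> machine" where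
  "sim_round n a M B r d =
     bind_pmf (map_pmf (\<lambda>res. list_data (map res [0..<n]))
       (Pi_pmf {..<n} Atom (\<lambda>i. if i = a then return_pmf Atom else M i (item (left d) i)))) (\<lambda>R.
     map_pmf (\<lambda>b.
       Node
         (list_data (map (\<lambda>j. Node (left (item R j))
            (inbox n (\<lambda>i. if i = a then right b else right (item R i)) j)) [0..<n]))
         (Node (left b)
            (list_data (map (\<lambda>k. item (right (right d)) k) [0..<r] @
               [Node (inbox n (\<lambda>i. right (item R i)) a) (sent n (right b))]))))
     (B (Node (left (right d)) (inbox n (\<lambda>i. right (item R i)) a))))"

lemma map_item_list_data: "length ds = r \<Longrightarrow> map (item (list_data ds)) [0..<r] = ds"
  by (rule nth_equalityI) (auto simp: item_list_data)

lemma sim_round_encode: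
  assumes "length (transcript c) = r"
  shows "sim_round n a M B r (encode n c) = map_pmf (encode n) (corrupt_round n a M B c)"
proof -
  have Pi: "Pi_pmf {..<n} Atom (\<lambda>i. if i = a then return_pmf Atom else M i (item (left (encode n c)) i)) =
      Pi_pmf ({..<n} - {a}) Atom (\<lambda>i. M i (honest c i))" (is "?L = _")
  proof -
    have "?L = Pi_pmf ({..<n} - {a}) Atom
        (\<lambda>i. if i = a then return_pmf Atom else M i (item (left (encode n c)) i))"
      by (rule Pi_pmf_subset') auto
    also have "\<dots> = Pi_pmf ({..<n} - {a}) Atom (\<lambda>i. M i (honest c i))"
      by (rule Pi_pmf_cong) (auto simp: encode_def item_list_data)
    finally show ?thesis .
  qed
  \<comment> \<open>The list is faithful only below \<open>n\<close>, but \<open>inbox\<close> reads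
    no other positions.\<close>
  have item: "item (list_data (map res [0..<n])) i = res i" if "i < n" for res i
    using that by (simp add: item_list_data)
  have inb1: "inbox n (\<lambda>i. right (item (list_data (map res [0..<n])) i)) j =
      inbox n (\<lambda>i. right (res i)) j" for res j
    by (rule inbox_cong) (simp add: item)
  have inb2: "inbox n (\<lambda>i. if i = a then u else right (item (list_data (map res [0..<n])) i)) j =
      inbox n (\<lambda>i. if i = a then u else right (res i)) j" for res u j
    by (rule inbox_cong) (simp add: item)
  have lst: "map (\<lambda>j. Node (left (item (list_data (map res [0..<n])) j)) (F j)) [0..<n] =
      map (\<lambda>j. Node (left (res j)) (F j)) [0..<n]" for res F
    by (rule map_cong) (auto simp: item)
  show ?thesis
    unfolding sim_round_def Pi corrupt_round_def bind_map_pmf map_bind_pmf inb1 inb2 lst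
    by (simp add: encode_def Let_def pmf.map_comp o_def map_item_list_data[OF assms])
qed

section \<open>Running time of the simulator relative to the adversary\<close>

lemma poly_time_rel_sim_round:
  assumes "\<And>i. i < n \<Longrightarrow> poly_time_rel Or (M i)" and "poly_time_rel Or B"
  shows "poly_time_rel Or (sim_round n a M B r)"
proof -
  have "poly_time_rel Or (\<lambda>d. if i = a then return_pmf Atom else M i (item (left d) i))"
    if "i \<in> set [0..<n]" for i
  proof (cases "i = a")
    case True
    then show ?thesis by (simp add: poly_time_rel_const)
  next
    case False
    have "poly_time_rel Or (\<lambda>d. M i (item (left d) i))"
      by (intro poly_time_rel_comp[OF assms(1)] poly_time_rel_intros) (use that in auto)
    with False show ?thesis by simp
  qed
  from poly_time_rel_Pi_pmf[where ks = "[0..<n]", OF this]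
  have Pi: "poly_time_rel Or (\<lambda>d. map_pmf (\<lambda>res. list_data (map res [0..<n]))
       (Pi_pmf {..<n} Atom (\<lambda>i. if i = a then return_pmf Atom else M i (item (left d) i))))"
    by (simp add: atLeast0LessThan)
  show ?thesis
    unfolding sim_round_def
    by (intro poly_time_rel_bind[OF Pi] poly_time_rel_map poly_time_rel_comp[OF assms(2)]
        poly_time_rel_intros)
qed

lemma poly_time_rel_leak:
  assumes "poly_time_rel Or B"
  shows "poly_time_rel Or (leak n a B)"
  unfolding leak_def leak_outbox_def
  by (intro poly_time_rel_map[OF assms] poly_time_rel_intros)

lemma poly_time_rel_act: "r \<le> rounds \<pi> \<Longrightarrow> poly_time_rel (adv_oracle \<pi> A a) (act A a r)"
  by (rule poly_time_rel_oracle[of _ "Suc r"]) (simp add: adv_oracle_def)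

lemma poly_time_rel_report: "poly_time_rel (adv_oracle \<pi> A a) (report A a)"
  by (rule poly_time_rel_oracle[of _ 0]) (simp add: adv_oracle_def)

text \<open>The inputs of the honest parties are constants of the program and only \<open>u\<close>
  is its input. Each round appends one \<open>sim_round\<close>, in which honest machines run
  without oracles and \<open>A\<close> is queried.\<close>

lemma poly_time_rel_phase1:
  assumes "poly_time_protocol n \<pi>" and "r \<le> rounds \<pi>"
  shows "poly_time_rel (adv_oracle \<pi> A a)
    (\<lambda>u. map_pmf (encode n) (corrupt_phase1 n \<pi> (leaky n A) a (x(a := u)) r))"
  using assms(2)
proof (induction r)
  case 0
  have "map_pmf (encode n) (corrupt_phase1 n \<pi> (leaky n A) a (x(a := u)) 0) =
      return_pmf (Node (list_data (map (\<lambda>i. Node (if i = a then u else x i) Atom) [0..<n]))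
        (Node u Atom))" for u
    \<comment> \<open>Unfolding stops at the conditional on \<open>i = a\<close>, a test that does
      not depend on \<open>u\<close>.\<close>
    by (simp only: corrupt_phase1.simps map_return_pmf encode_def init_states_def config.simps
      fun_upd_apply list_data.simps if_True refl)
  then show ?case
    by (simp only:) (intro poly_time_rel_intros)
next
  case (Suc r)
  have eq: "map_pmf (encode n) (corrupt_phase1 n \<pi> (leaky n A) a (x(a := u)) (Suc r)) =
      bind_pmf (map_pmf (encode n) (corrupt_phase1 n \<pi> (leaky n A) a (x(a := u)) r))
        (sim_round n a (comp_step \<pi> r) (leak n a (act A a r)) r)" for u
    unfolding corrupt_phase1.simps map_bind_pmf bind_map_pmf leaky_simps
    by (rule bind_pmf_cong[OF refl]) (rule sim_round_encode[OF length_transcript, symmetric])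
  show ?case
    unfolding eq
  proof (rule poly_time_rel_seq[OF Suc.IH[OF Suc_leD[OF Suc.prems]] poly_time_rel_sim_round])
    show "poly_time_rel (adv_oracle \<pi> A a) (comp_step \<pi> r i)" if "i < n" for i
      using assms(1) Suc.prems that by (intro poly_time_imp_rel) (simp add: poly_time_protocol_def)
    show "poly_time_rel (adv_oracle \<pi> A a) (leak n a (act A a r))"
      using Suc.prems by (intro poly_time_rel_leak poly_time_rel_act) simp
  qed
qed

text \<open>The state kept between the two stages is the simulated view, and \<open>x\<close> holds
  the default inputs of the honest parties. There is no abort: by correctness the honest parties
  obtain a result whatever \<open>A\<close> does. The answer \<open>Some y\<close> is encoded as
  \<open>Node Atom y\<close>, so \<open>right (right d)\<close> is \<open>y\<close>.\<close>

definition simulator :: "nat \<Rightarrow> protocol \<Rightarrow> adversary \<Rightarrow> (nat \<Rightarrow> data) \<Rightarrow> (nat \<Rightarrow> data \<Rightarrow> data) \<Rightarrow>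
    (nat \<Rightarrow> data \<Rightarrow> data \<Rightarrow> data pmf) \<Rightarrow> ideal_adversary" where
  "simulator n \<pi> A x ext D =
     \<lparr>submit = (\<lambda>a u. map_pmf (\<lambda>v. Node v (of_opt (Some (ext a v))))
        (map_pmf view1 (execution n \<pi> (leaky n A) a (x(a := u))))),
      conclude = (\<lambda>a d. bind_pmf (D a (left d) (right (right d))) (reply A (rounds \<pi>) a (left d)))\<rparr>"

lemma poly_time_rel_view1:
  assumes "poly_time_protocol n \<pi>"
  shows "poly_time_rel (adv_oracle \<pi> A a)
    (\<lambda>u. map_pmf view1 (execution n \<pi> (leaky n A) a (x(a := u))))"
proof -
  have eq: "map_pmf view1 (execution n \<pi> (leaky n A) a (x(a := u))) =
    map_pmf (\<lambda>d. Node u (right (right d)))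
      (map_pmf (encode n) (corrupt_phase1 n \<pi> (leaky n A) a (x(a := u)) (rounds \<pi>)))" for u
    by (simp add: map_view1_execution pmf.map_comp o_def encode_def)
  show ?thesis
    unfolding eq
    by (intro poly_time_rel_map[OF poly_time_rel_phase1[OF assms]] poly_time_rel_intros) simp
qed

lemma poly_time_rel_reply:
  "poly_time_rel (adv_oracle \<pi> A a) (\<lambda>d. reply A (rounds \<pi>) a (left d) (right d))"
proof -
  have "poly_time_rel (adv_oracle \<pi> A a)
      (\<lambda>d. return_pmf (Node (leaked_state (rounds \<pi>) a (left d)) (right d)))"
    unfolding leaked_state_def by (intro poly_time_rel_intros)
  from poly_time_rel_comp[OF poly_time_rel_act[OF order_refl] this] show ?thesis
    unfolding reply_def
    by (intro poly_time_rel_seq poly_time_rel_comp[OF poly_time_rel_report] poly_time_rel_intros)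
qed

lemma poly_time_simulator_simulator:
  assumes "poly_time_protocol n \<pi>"
    and ext: "\<And>a. a < n \<Longrightarrow> poly_time (\<lambda>v. return_pmf (ext a v))"
    and D: "\<And>a. a < n \<Longrightarrow> poly_time (\<lambda>d. D a (left d) (right d))"
  shows "poly_time_simulator n \<pi> A (simulator n \<pi> A x ext D)"
  unfolding poly_time_simulator_def simulator_def ideal_adversary.simps of_opt.simps
proof (intro allI impI conjI)
  fix a assume "a < n"
  note ext' = poly_time_rel_comp[OF poly_time_imp_rel[OF ext[OF \<open>a < n\<close>]]]
  show "poly_time_rel (adv_oracle \<pi> A a) (\<lambda>u. map_pmf (\<lambda>v. Node v (Node Atom (ext a v)))
        (map_pmf view1 (execution n \<pi> (leaky n A) a (x(a := u)))))"
    by (intro poly_time_rel_map[OF poly_time_rel_view1[OF assms(1)]] poly_time_rel_intros ext')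
  \<comment> \<open>The sampler expects view and result as one tree, so the tag of the encoded
    answer is stripped first.\<close>
  have "poly_time_rel (adv_oracle \<pi> A a) (\<lambda>d. D a (left d) (right (right d)))"
    using poly_time_rel_comp[OF poly_time_imp_rel[OF D[OF \<open>a < n\<close>]],
        of "adv_oracle \<pi> A a" "\<lambda>d. Node (left d) (right (right d))"]
    by (simp add: poly_time_rel_intros)
  moreover have "poly_time_rel (adv_oracle \<pi> A a)
      (\<lambda>d. reply A (rounds \<pi>) a (left (left d)) (right d))"
    using poly_time_rel_comp[OF poly_time_rel_reply, of \<pi> A a "\<lambda>d. Node (left (left d)) (right d)"]
    by (simp add: poly_time_rel_intros)
  ultimately show "poly_time_rel (adv_oracle \<pi> A a)
      (\<lambda>d. bind_pmf (D a (left d) (right (right d))) (reply A (rounds \<pi>) a (left d)))"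
    by (rule poly_time_rel_bind)
qed

section \<open>Validity of the simulator and equality of the two models\<close>

lemma outputs_execution:
  assumes "ni_correct n X f \<pi> ext A a" and "x \<in> Pi\<^sub>E {..<n} X" and "e \<in> set_pmf (execution n \<pi> A a x)"
  shows "outputs e = (\<lambda>i. if i < n \<and> i \<noteq> a then Some (f (x(a := ext a (view1 e)))) else None)"
proof (rule ext)
  fix i
  show "outputs e i = (if i < n \<and> i \<noteq> a then Some (f (x(a := ext a (view1 e)))) else None)"
  proof (cases "i < n \<and> i \<noteq> a")
    case True
    with assms(1,2) have "measure_pmf.prob (execution n \<pi> A a x)
        {e. outputs e i = Some (f (x(a := ext a (view1 e))))} = 1"
      unfolding ni_correct_def by blast
    \<comment> \<open>For a discrete distribution, probability 1 means that the equation holds on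
      the whole support.\<close>
    then have "AE e in execution n \<pi> A a x. outputs e i = Some (f (x(a := ext a (view1 e))))"
      by (subst (asm) measure_pmf.prob_eq_1) auto
    with assms(3) True show ?thesis by (simp add: AE_measure_pmf_iff)
  next
    case False
    \<comment> \<open>At \<open>a\<close> and from \<open>n\<close> on, the product of the output
      distributions takes its default value \<open>None\<close>.\<close>
    from assms(3) obtain p where "outputs e \<in> set_pmf (Pi_pmf ({..<n} - {a}) None p)"
      by (auto simp: execution_def)
    with False set_Pi_pmf_subset[of "{..<n} - {a}" None p] show ?thesis by auto
  qed
qed

text \<open>In the real model the honest outputs are a function of the view, the final messages are
  drawn from view and result, and the report from view and messages. What remains is the view on
  \<open>x\<close>, which input independence equates with the view on \<open>x0(a := x a)\<close>
  that the simulator samples.\<close>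

lemma ideal_model_simulator:
  assumes "a < n" and "x \<in> Pi\<^sub>E {..<n} X" and "x0 \<in> Pi\<^sub>E {..<n} X"
    and correct: "ni_correct n X f \<pi> ext (leaky n A) a"
    and indep: "ni_input_independent n X \<pi> (leaky n A) a"
    and sim: "map_pmf (\<lambda>e. (view1 e, final_msgs e)) (execution n \<pi> (leaky n A) a x) =
           bind_pmf (map_pmf view1 (execution n \<pi> (leaky n A) a x))
             (\<lambda>v. map_pmf (Pair v) (D a v (f (x(a := ext a v)))))"
  shows "ideal_model n f (simulator n \<pi> A x0 ext D) a x = real_model n \<pi> A a x"
proof -
  let ?E = "execution n \<pi> (leaky n A) a x"
  define out where "out v = (\<lambda>i. if i < n \<and> i \<noteq> a then Some (f (x(a := ext a v))) else None)" for v
  have "x0(a := x a) \<in> Pi\<^sub>E {..<n} X" using assms(1-3) by (auto simp: PiE_def extensional_def)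
  from indep[unfolded ni_input_independent_def, rule_format, OF this assms(2)] have view:
    "map_pmf view1 (execution n \<pi> (leaky n A) a (x0(a := x a))) = map_pmf view1 ?E"
    by simp
  have "real_model n \<pi> A a x = map_pmf (\<lambda>e. (outputs e, adv_out e)) ?E"
    by (simp only: real_model_leaky[OF assms(1), of \<pi> A x, symmetric])
       (rule real_model_def)
  also have "\<dots> = map_pmf (\<lambda>e. (out (view1 e), adv_out e)) ?E"
    by (rule map_pmf_cong) (simp_all add: outputs_execution[OF correct assms(2)] out_def)
  also have "\<dots> = map_pmf (\<lambda>(v, m, z). (out v, z))
      (map_pmf (\<lambda>e. (view1 e, final_msgs e, adv_out e)) ?E)"
    by (simp add: pmf.map_comp o_def)
  also have "\<dots> = bind_pmf (map_pmf view1 ?E) (\<lambda>v.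
      bind_pmf (D a v (f (x(a := ext a v)))) (\<lambda>m.
      map_pmf (Pair (out v)) (reply A (rounds \<pi>) a v m)))"
    unfolding map_adv_out_execution_leaky[OF assms(1)] sim
    by (simp add: map_bind_pmf bind_map_pmf bind_assoc_pmf pmf.map_comp o_def)
  also have "\<dots> = ideal_model n f (simulator n \<pi> A x0 ext D) a x"
    unfolding ideal_model_def simulator_def ideal_adversary.simps view out_def
    by (simp add: bind_map_pmf map_bind_pmf Let_def cong: if_cong)
  finally show ?thesis ..
qed

text \<open>The correctness condition also places extracted inputs in \<open>X a\<close>; it is
  applied to the simulated input vector \<open>x0(a := u)\<close>.\<close>

lemma valid_simulator:
  assumes "x0 \<in> Pi\<^sub>E {..<n} X" and "\<And>a. a < n \<Longrightarrow> ni_correct n X f \<pi> ext (leaky n A) a"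
  shows "valid_ideal_adversary n X (simulator n \<pi> A x0 ext D)"
  unfolding valid_ideal_adversary_def
proof (intro allI impI ballI)
  fix a u d
  assume a: "a < n" and "u \<in> X a" and d: "d \<in> set_pmf (submit (simulator n \<pi> A x0 ext D) a u)"
  then have "x0(a := u) \<in> Pi\<^sub>E {..<n} X" using assms(1) by (auto simp: PiE_def extensional_def)
  with assms(2)[OF a] d show "set_option (to_opt (right d)) \<subseteq> X a"
    unfolding ni_correct_def simulator_def by auto
qed

theorem theorem2:
  fixes n :: nat
    and X :: "nat \<Rightarrow> data set"
    and Y :: "data set"
    and f :: "(nat \<Rightarrow> data) \<Rightarrow> data"
    and \<pi> :: protocol
  assumes "f \<in> Pi\<^sub>E {..<n} X \<rightarrow> Y"
    and "poly_time_protocol n \<pi>"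
    and "computes n X \<pi> f"
    and "ni_secure n X f \<pi>"
  shows "sim_secure n X f \<pi>"
  unfolding sim_secure_def
proof
  fix A
  show "\<exists>S. valid_ideal_adversary n X S \<and> poly_time_simulator n \<pi> A S \<and>
        (\<forall>a<n. \<forall>x \<in> Pi\<^sub>E {..<n} X. ideal_model n f S a x = real_model n \<pi> A a x)"
  proof (cases "Pi\<^sub>E {..<n} X = {}")
    case True
    \<comment> \<open>No default inputs exist here, but there is nothing to simulate either.
      Submitting \<open>Atom\<close> is an abort, since its right part decodes to
      \<open>None\<close>, and an abort is always valid.\<close>
    then show ?thesis
      by (intro exI[of _ "\<lparr>submit = \<lambda>a u. return_pmf Atom, conclude = \<lambda>a u. return_pmf Atom\<rparr>"])
         (simp add: valid_ideal_adversary_def poly_time_simulator_def poly_time_rel_const)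
  next
    case False
    then obtain x0 where x0: "x0 \<in> Pi\<^sub>E {..<n} X" by blast
    obtain ext where ext: "\<forall>i<n. poly_time (\<lambda>v. return_pmf (ext i v))"
      and ni: "\<forall>a<n. \<forall>A. ni_correct n X f \<pi> ext A a \<and> ni_input_independent n X \<pi> A a \<and>
           ni_output_simulatable n X f \<pi> ext A a"
      using assms(4) unfolding ni_secure_def by blast
    \<comment> \<open>Output simulation gives a sampler for each corrupted party, whereas one
      simulator serves all of them, so a family indexed by \<open>a\<close> is chosen.\<close>
    have "\<forall>a. \<exists>D. a < n \<longrightarrow> poly_time (\<lambda>d. D (left d) (right d)) \<and>
        (\<forall>x \<in> Pi\<^sub>E {..<n} X.
           map_pmf (\<lambda>e. (view1 e, final_msgs e)) (execution n \<pi> (leaky n A) a x) =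
           bind_pmf (map_pmf view1 (execution n \<pi> (leaky n A) a x))
             (\<lambda>v. map_pmf (Pair v) (D v (f (x(a := ext a v))))))"
      using ni unfolding ni_output_simulatable_def by blast
    from choice[OF this] obtain D where D: "\<forall>a. a < n \<longrightarrow> poly_time (\<lambda>d. D a (left d) (right d)) \<and>
        (\<forall>x \<in> Pi\<^sub>E {..<n} X.
           map_pmf (\<lambda>e. (view1 e, final_msgs e)) (execution n \<pi> (leaky n A) a x) =
           bind_pmf (map_pmf view1 (execution n \<pi> (leaky n A) a x))
             (\<lambda>v. map_pmf (Pair v) (D a v (f (x(a := ext a v))))))" ..
    show ?thesis
    proof (intro exI[of _ "simulator n \<pi> A x0 ext D"] conjI allI impI ballI)
      show "valid_ideal_adversary n X (simulator n \<pi> A x0 ext D)"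
        using valid_simulator[OF x0] ni by blast
      show "poly_time_simulator n \<pi> A (simulator n \<pi> A x0 ext D)"
        using poly_time_simulator_simulator[OF assms(2)] ext D by blast
      show "ideal_model n f (simulator n \<pi> A x0 ext D) a x = real_model n \<pi> A a x"
        if "a < n" "x \<in> Pi\<^sub>E {..<n} X" for a x
        using ideal_model_simulator[OF that x0] ni D that by blast
    qed
  qed
qed

end
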